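(* Let $f:\mathbb{R}^d\to\mathbb{R}$ be $M$-Lipschitz and convex with nonempty set of minimizers $X_\star$, and suppose for some $\mu>0$ and $p\ge2$ that $f(x)-f_\star\ge\mu\operatorname{dist}(x,X_\star)^p$ for all $x$ with $f(x)\le f(x^{(0)})$. Let $\Delta_0=f(x^{(0)})-f_\star$ and $0<\epsilon<\Delta_0$. Run the Dynamic Restarting Scheme (described in the context) from $x^{(0)}$ with $\mathtt{fom}(\epsilon)$ equal to the subgradient method (described in the context), $N_0=1$, and $\epsilon_k=\frac\epsilon{2e}\exp(c^k)$ for any $c\in(1,3-\frac2p)$. Then the scheme computes an $\epsilon$-optimal solution with iteration complexity and oracle complexity respectively at most $$\mathcal{O}\left(\frac{M^2}{\mu^{2/p}}\cdot\frac1{\epsilon^{2-\frac2p}}\right)\quad\text{and}\quad\mathcal{O}\left(\frac{M^2}{\mu^{2/p}}\cdot\frac1{\epsilon^{2-\frac2p}}\cdot\log\log\left(\frac{\Delta_0}\epsilon\right)\right).$$ No other choice of $\{\epsilon_k\}$ asymptotically improves these rates in the bound $$B(\{\epsilon_k\})=\sum_{k=0}^{m-1}\left(1+\frac{2\epsilon_{k+1}}{\epsilon_k}\right)K_{\mathtt{dec}}\left(\epsilon_k,2\epsilon_k,(2\epsilon_k/\mu)^{1/p}\right),\qquad K_{\mathtt{dec}}(\epsilon,\delta,D)=\frac{M^2D^2}{2\epsilon(\delta-\frac32\epsilon)},$$ even in the $\log\log$ factor: over all strictly increasing positive sequences $\{\epsilon_k\}_{k\ge0}$ with $\epsilon_0\le\epsilon/2$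 and $\epsilon_k\to\infty$, the infimum of $B(\{\epsilon_k\})$ (iteration bound) and the infimum of $(\hat m+1)B(\{\epsilon_k\})$ (oracle bound) are, respectively, at least of the order ($\Omega$) of the two displayed rates, where $m=\inf\{k:\epsilon_k\ge\Delta_0/2\}$ and $\hat m=\inf\{k:\epsilon_k>\Delta_0\}$.
   Context: Notation: $f_\star=\min f$, $X_\star=\operatorname{argmin} f$, $\operatorname{dist}(y,X_\star)=\inf_{x\in X_\star}\|y-x\|_2$. $x$ is $\epsilon$-optimal if $f(x)-f_\star\le\epsilon$. Asymptotic notations are with respect to $\epsilon\to0$ ($p$ and $c$ fixed, dependence on $M,\mu,\Delta_0$ as displayed). Iteration complexity is the number of rounds of the scheme until some $\overline x^{(t)}$ (defined below) is $\epsilon$-optimal; oracle complexity is the total number of $\mathtt{fom}$ iterations performed over all processes up to then. Subgradient method $\mathtt{fom}(\epsilon)$: given the iterate $x^{(i)}$ take $g^{(i)}\in\partial f(x^{(i)})$; if $g^{(i)}=0$, terminate and declare $x^{(i)}$ a minimizer; otherwise $x^{(i+1)}=x^{(i)}-\frac{\epsilon}{\|g^{(i)}\|_2^2}g^{(i)}$. Dynamic Restarting Scheme. Input: $x^{(0)}$, strictly increasing positive targets $\{\epsilon_k\}_{k\ge0}$ with $\epsilon_k\to\infty$, $\mathtt{fom}$, and an initial process count $N_0\ge1$. Process $P_k$ runs $\mathtt{fom}(\epsilon_k)$ and stores a reference point; its task is to obtain a point $\overline x$ with $f(\overline x)\le f(\text{reference point of }P_k)-\epsilon_k$. Round $0$: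 set $\overline x^{(0)}=x^{(0)}$ and launch $P_0,\dots,P_{N_0-1}$, each with initial point and reference point $x^{(0)}$. Round $t=1,2,\dots$: (Step 1) every process currently in the scheme runs one iteration; let $\overline x^{(t)}$ be an iterate with minimum objective value among all new iterates of this round. (Step 2) For each process $P_k$ that was in the scheme at the beginning of round $t$: if $\overline x^{(t)}$ accomplishes the task of $P_k$, then $P_k$ is restarted at $\overline x^{(t)}$ (its memory is cleared, it then behaves as $\mathtt{fom}(\epsilon_k)$ started from $\overline x^{(t)}$, and its reference point becomes $\overline x^{(t)}$); if moreover $P_k$ is the highest-indexed process entering round $t$, a new process $P_{k+1}$ is launched with initial point and reference point $\overline x^{(t)}$ (its first iteration occurs in round $t+1$). Otherwise $P_k$ continues unchanged. *)

theory Defs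
  imports "HOL-Analysis.Analysis"
begin

text \<open>
  The Euclidean space of dimension \<open>d\<close> is modelled as a \<open>d\<close>-dimensional subspace \<open>E\<close> of a real
  inner product space, with the inherited inner product and norm; functions on it are only ever
  evaluated on \<open>E\<close>. For \<open>real ^ 'n\<close> take \<open>E = UNIV\<close>. Having \<open>E\<close> as a term rather than a type lets
  constants be chosen before \<open>E\<close>, that is, independently of the dimension: in an infinite-dimensional
  type every \<open>d\<close> occurs.
\<close>

definition euclidean_subspace :: "nat \<Rightarrow> 'a::real_inner set \<Rightarrow> bool" where
  "euclidean_subspace d E \<longleftrightarrow> (\<exists>B. finite B \<and> card B = d \<and> independent B \<and> span B = E)"

definition minimizers :: "'a set \<Rightarrow> ('a \<Rightarrow> real) \<Rightarrow> 'a set" where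
  "minimizers E f = {x. is_arg_min f (\<lambda>y. y \<in> E) x}"

text \<open>This is the minimum of \<open>f\<close> over \<open>E\<close> as soon as \<open>minimizers E f\<close> is nonempty.\<close>

definition min_value :: "'a set \<Rightarrow> ('a \<Rightarrow> real) \<Rightarrow> real" where
  "min_value E f = (INF x\<in>E. f x)"

definition subdifferential :: "'a::real_inner set \<Rightarrow> ('a \<Rightarrow> real) \<Rightarrow> 'a \<Rightarrow> 'a set" where
  "subdifferential E f x = {g \<in> E. \<forall>y\<in>E. f y \<ge> f x + g \<bullet> (y - x)}"

text \<open>
  One iteration of the subgradient method with target \<open>e\<close>, as a relation because the subgradient
  is an arbitrary one. A process that finds \<open>g = 0\<close> has declared \<open>x\<close> a minimizer; by convention it
  then stays at \<open>x\<close>. In the scheme below such an \<open>x\<close> is the starting point or was among the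
  iterates of an earlier round, so if the starting point is not a minimizer, then the best point
  of that earlier round was already optimal and the convention does not influence the complexities.
\<close>

definition subgradient_step ::
  "'a::real_inner set \<Rightarrow> ('a \<Rightarrow> real) \<Rightarrow> real \<Rightarrow> 'a \<Rightarrow> 'a \<Rightarrow> bool" where
  "subgradient_step E f e x y \<longleftrightarrow>
     (\<exists>g \<in> subdifferential E f x. y = (if g = 0 then x else x - (e / (norm g)\<^sup>2) *\<^sub>R g))"

text \<open>
  State of the restarting scheme at the end of a round: the processes present are those with index
  \<open>k < nproc\<close>; \<open>iter k\<close> is the point from which process \<open>k\<close> makes its next iteration, \<open>refp k\<close> its
  reference point, and \<open>best\<close> the best new iterate of the round. The method is
  memoryless beyond its current iterate, so restarting a process amounts to resetting
  \<open>iter\<close> and \<open>refp\<close>.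
\<close>

record 'a scheme_state =
  nproc :: nat
  iter :: "nat \<Rightarrow> 'a"
  refp :: "nat \<Rightarrow> 'a"
  best :: 'a

definition initial_state :: "nat \<Rightarrow> 'a \<Rightarrow> 'a scheme_state" where
  "initial_state N0 x0 = \<lparr>nproc = N0, iter = (\<lambda>_. x0), refp = (\<lambda>_. x0), best = x0\<rparr>"

definition accomplishes ::
  "('a \<Rightarrow> real) \<Rightarrow> (nat \<Rightarrow> real) \<Rightarrow> 'a scheme_state \<Rightarrow> 'a \<Rightarrow> nat \<Rightarrow> bool" where
  "accomplishes f es s xb k \<longleftrightarrow> f xb \<le> f (refp s k) - es k"

text \<open>
  One round, with \<open>fom e x y\<close> meaning that \<open>y\<close> is a possible next iterate of the first-order method
  with target \<open>e\<close> at \<open>x\<close>, and \<open>y k\<close> the new iterate of process \<open>k\<close>.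
\<close>

definition scheme_round ::
  "('a \<Rightarrow> real) \<Rightarrow> (real \<Rightarrow> 'a \<Rightarrow> 'a \<Rightarrow> bool) \<Rightarrow> (nat \<Rightarrow> real) \<Rightarrow>
   'a scheme_state \<Rightarrow> 'a scheme_state \<Rightarrow> bool" where
  "scheme_round f fom es s s' \<longleftrightarrow>
    (\<exists>y. (\<forall>k<nproc s. fom (es k) (iter s k) (y k)) \<and>
         (\<exists>j<nproc s. best s' = y j \<and> (\<forall>k<nproc s. f (y j) \<le> f (y k))) \<and>
         (\<forall>k<nproc s.
            if accomplishes f es s (best s') k
            then iter s' k = best s' \<and> refp s' k = best s'
            else iter s' k = y k \<and> refp s' k = refp s k)) \<and>
    (if accomplishes f es s (best s') (nproc s - 1)
     then nproc s' = Suc (nproc s) \<and> iter s' (nproc s) = best s' \<and> refp s' (nproc s) = best s'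
     else nproc s' = nproc s)"

definition scheme_run ::
  "('a \<Rightarrow> real) \<Rightarrow> (real \<Rightarrow> 'a \<Rightarrow> 'a \<Rightarrow> bool) \<Rightarrow> (nat \<Rightarrow> real) \<Rightarrow> nat \<Rightarrow> 'a \<Rightarrow>
   (nat \<Rightarrow> 'a scheme_state) \<Rightarrow> bool" where
  "scheme_run f fom es N0 x0 S \<longleftrightarrow>
     S 0 = initial_state N0 x0 \<and> (\<forall>t. scheme_round f fom es (S t) (S (Suc t)))"

definition eps_optimal :: "'a set \<Rightarrow> ('a \<Rightarrow> real) \<Rightarrow> real \<Rightarrow> 'a \<Rightarrow> bool" where
  "eps_optimal E f \<epsilon> x \<longleftrightarrow> f x - min_value E f \<le> \<epsilon>"

text \<open>
  The complexities of a single run are meaningful only if it reaches an \<open>\<epsilon>\<close>-optimal point.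
  Round \<open>t + 1\<close> costs \<open>nproc (S t)\<close> iterations of the first-order method.
\<close>

definition iteration_complexity ::
  "'a set \<Rightarrow> ('a \<Rightarrow> real) \<Rightarrow> real \<Rightarrow> (nat \<Rightarrow> 'a scheme_state) \<Rightarrow> nat" where
  "iteration_complexity E f \<epsilon> S = (LEAST t. eps_optimal E f \<epsilon> (best (S t)))"

definition oracle_complexity ::
  "'a set \<Rightarrow> ('a \<Rightarrow> real) \<Rightarrow> real \<Rightarrow> (nat \<Rightarrow> 'a scheme_state) \<Rightarrow> nat" where
  "oracle_complexity E f \<epsilon> S = (\<Sum>t<iteration_complexity E f \<epsilon> S. nproc (S t))"

definition K_dec :: "real \<Rightarrow> real \<Rightarrow> real \<Rightarrow> real \<Rightarrow> real" where
  "K_dec M e \<delta> D = M\<^sup>2 * D\<^sup>2 / (2 * e * (\<delta> - 3 / 2 * e))"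

definition m_index :: "real \<Rightarrow> (nat \<Rightarrow> real) \<Rightarrow> nat" where
  "m_index \<Delta> es = Inf {k. es k \<ge> \<Delta> / 2}"

definition mhat_index :: "real \<Rightarrow> (nat \<Rightarrow> real) \<Rightarrow> nat" where
  "mhat_index \<Delta> es = Inf {k. es k > \<Delta>}"

definition iteration_bound :: "real \<Rightarrow> real \<Rightarrow> real \<Rightarrow> real \<Rightarrow> (nat \<Rightarrow> real) \<Rightarrow> real" where
  "iteration_bound M \<mu> p \<Delta> es =
     (\<Sum>k<m_index \<Delta> es. (1 + 2 * es (Suc k) / es k) *
        K_dec M (es k) (2 * es k) ((2 * es k / \<mu>) powr (1 / p)))"

definition admissible_targets :: "real \<Rightarrow> (nat \<Rightarrow> real) set" where
  "admissible_targets \<epsilon> =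
     {es. strict_mono es \<and> (\<forall>k. es k > 0) \<and> es 0 \<le> \<epsilon> / 2 \<and> filterlim es at_top sequentially}"

definition exp_targets :: "real \<Rightarrow> real \<Rightarrow> nat \<Rightarrow> real" where
  "exp_targets \<epsilon> c k = \<epsilon> / (2 * exp 1) * exp (c ^ k)"

definition iteration_rate :: "real \<Rightarrow> real \<Rightarrow> real \<Rightarrow> real \<Rightarrow> real" where
  "iteration_rate M \<mu> p \<epsilon> = M\<^sup>2 / \<mu> powr (2 / p) * (1 / \<epsilon> powr (2 - 2 / p))"

definition oracle_rate :: "real \<Rightarrow> real \<Rightarrow> real \<Rightarrow> real \<Rightarrow> real \<Rightarrow> real" where
  "oracle_rate M \<mu> p \<Delta> \<epsilon> = iteration_rate M \<mu> p \<epsilon> * ln (ln (\<Delta> / \<epsilon>))"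

end

theory Submission
  imports Defs
begin

text \<open>
  Upper bounds. While every gap seen so far is at least \<open>2 \<epsilon>\<^sub>k\<close>, process \<open>k\<close> brings its iterate
  closer to the minimizers in every round and, by the growth condition, is restarted within a
  number \<open>w\<^sub>k\<close> of rounds of order \<open>M\<^sup>2 \<mu>\<^bsup>-2/p\<^esup> \<epsilon>\<^sub>k\<^bsup>2/p-2\<^esup>\<close>; this uses \<open>p \<ge> 2\<close>. Each restart lowers
  its reference value by \<open>\<epsilon>\<^sub>k\<close>. Charge each round before \<open>\<epsilon>\<close>-optimality to the largest
  existing \<open>k\<close> with \<open>2 \<epsilon>\<^sub>k\<close> at most the smallest gap seen: then either \<open>k\<close> is the newest process, not yet
  restarted, or the smallest gap is below \<open>2 \<epsilon>\<^sub>k\<^sub>+\<^sub>1\<close>. So \<open>k\<close> is charged for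
  \<open>O(w\<^sub>k \<epsilon>\<^sub>k\<^sub>+\<^sub>1 / \<epsilon>\<^sub>k)\<close> rounds, which for the exponential targets is the rate times
  \<open>exp (- (3 - 2 / p - c) c\<^sup>k)\<close>, a summable factor. A process \<open>k + 1\<close> is only launched if
  \<open>\<epsilon>\<^sub>k \<le> \<Delta>\<^sub>0\<close>, so there are \<open>O(log log (\<Delta>\<^sub>0 / \<epsilon>))\<close> processes.

  Lower bounds. If the bound is \<open>L\<close> times the rate, its \<open>k\<close>-th summand gives
  \<open>\<epsilon>\<^sub>k\<^sub>+\<^sub>1 / \<epsilon> \<le> L (\<epsilon>\<^sub>k / \<epsilon>)\<^bsup>3-2/p\<^esup>\<close>, hence \<open>ln (\<epsilon>\<^sub>m / \<epsilon>) \<le> 3\<^sup>m ln L\<close>, and therefore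
  \<open>log log (\<Delta>\<^sub>0 / \<epsilon>)\<close> is \<open>O(m + log log L)\<close>, a fortiori \<open>O((m + 1) L)\<close>.
\<close>

section \<open>The iteration bound measured against the rate, and its lower bound\<close>

text \<open>For \<open>\<delta> = 2 * e\<close> the denominator of \<open>K_dec\<close> collapses to
  \<open>e\<^sup>2\<close>, leaving a pure power of \<open>e\<close>.\<close>

lemma K_dec_doubled:
  assumes "e > 0" "\<mu> > 0"
  shows "K_dec M e (2 * e) ((2 * e / \<mu>) powr (1 / p)) =
    M\<^sup>2 / \<mu> powr (2 / p) * (2 powr (2 / p) * e powr (2 / p - 2))"
proof -
  have "((2 * e / \<mu>) powr (1 / p))\<^sup>2 = (2 * e / \<mu>) powr (2 / p)"
    using assms by (simp add: powr_power)
  also have "\<dots> = 2 powr (2 / p) * e powr (2 / p) / \<mu> powr (2 / p)"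
    using assms by (simp add: powr_divide powr_mult)
  finally have "((2 * e / \<mu>) powr (1 / p))\<^sup>2 = 2 powr (2 / p) * e powr (2 / p) / \<mu> powr (2 / p)" .
  moreover have "e powr (2 / p - 2) = e powr (2 / p) / e\<^sup>2"
    using assms by (simp add: powr_diff powr_numeral)
  moreover have "2 * e * (2 * e - 3 / 2 * e) = e\<^sup>2"
    by (simp add: power2_eq_square field_simps)
  ultimately show ?thesis by (simp add: K_dec_def)
qed

lemma exp_targets_admissible:
  assumes "0 < \<epsilon>" "1 < c"
  shows "exp_targets \<epsilon> c \<in> admissible_targets \<epsilon>"
proof -
  have "strict_mono (exp_targets \<epsilon> c)"
    unfolding strict_mono_Suc_iff exp_targets_def
    using assms by (intro allI mult_strict_left_mono) (simp_all add: power_strict_increasing)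
  moreover have "filterlim (exp_targets \<epsilon> c) at_top sequentially"
    unfolding exp_targets_def
    using assms by (intro filterlim_tendsto_pos_mult_at_top[OF tendsto_const]
        filterlim_compose[OF exp_at_top] filterlim_at_infinity_imp_filterlim_at_top
        filterlim_realpow_sequentially_gt1) auto
  ultimately show ?thesis
    using assms by (simp add: admissible_targets_def exp_targets_def)
qed

text \<open>The iteration bound with the factor \<open>2 powr (2 / p)\<close> and the rate taken
  out. It is free of \<open>M\<close> and \<open>\<mu>\<close>, so it makes sense even for
  \<open>M = 0\<close>. It plays the part of \<open>L\<close> in the overview.\<close>

definition normalized_bound :: "real \<Rightarrow> real \<Rightarrow> real \<Rightarrow> (nat \<Rightarrow> real) \<Rightarrow> real" where
  "normalized_bound p \<epsilon> \<Delta> es = \<epsilon> powr (2 - 2 / p) *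
     (\<Sum>k<m_index \<Delta> es. (1 + 2 * es (Suc k) / es k) * es k powr (2 / p - 2))"

lemma iteration_bound_eq:
  assumes "\<And>k. es k > 0" "\<mu> > 0" "\<epsilon> > 0"
  shows "iteration_bound M \<mu> p \<Delta> es =
    2 powr (2 / p) * iteration_rate M \<mu> p \<epsilon> * normalized_bound p \<epsilon> \<Delta> es"
proof -
  have "M\<^sup>2 / \<mu> powr (2 / p) = iteration_rate M \<mu> p \<epsilon> * \<epsilon> powr (2 - 2 / p)"
    using assms by (simp add: iteration_rate_def)
  then show ?thesis
    unfolding iteration_bound_def normalized_bound_def sum_distrib_left K_dec_doubled[OF assms(1,2)]
    by (simp only: mult_ac)
qed

lemma
  assumes "filterlim es at_top sequentially"
  shows m_index_reached: "es (m_index \<Delta> es) \<ge> \<Delta> / 2"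
    and mhat_index_reached: "es (mhat_index \<Delta> es) > \<Delta>"
proof -
  have ev: "\<forall>\<^sub>F k in sequentially. es k > C" for C
    using assms by (simp add: filterlim_at_top_dense)
  from ev[of "\<Delta> / 2"] have "{k. es k \<ge> \<Delta> / 2} \<noteq> {}"
    by (metis (mono_tags, lifting) empty_Collect_eq eventually_sequentially less_imp_le order_refl)
  from Inf_nat_def1[OF this] show "es (m_index \<Delta> es) \<ge> \<Delta> / 2"
    by (simp add: m_index_def)
  from ev[of "\<Delta>"] have "{k. es k > \<Delta>} \<noteq> {}"
    by (metis (mono_tags, lifting) empty_Collect_eq eventually_sequentially order_refl)
  from Inf_nat_def1[OF this] show "es (mhat_index \<Delta> es) > \<Delta>"
    by (simp add: mhat_index_def)
qed

lemma m_index_le_mhat_index: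
  assumes "filterlim es at_top sequentially" "\<Delta> > 0"
  shows "m_index \<Delta> es \<le> mhat_index \<Delta> es"
proof -
  have "mhat_index \<Delta> es \<in> {k. es k \<ge> \<Delta> / 2}"
    using mhat_index_reached[OF assms(1), of \<Delta>] assms(2) by simp
  then show ?thesis
    unfolding m_index_def by (rule cInf_lower) simp
qed

text \<open>Each summand is at most the whole nonnegative sum. Summand 0 gives the constant 3,
  because successive ratios exceed 1 and \<open>es 0 \<le> \<epsilon>\<close>; summand
  \<open>k\<close>, solved for \<open>es (Suc k)\<close>, gives the recursion.\<close>

lemma normalized_bound_ge:
  assumes "p \<ge> 2" "es \<in> admissible_targets \<epsilon>" "0 < \<epsilon>" "\<epsilon> < \<Delta>"
  shows "normalized_bound p \<epsilon> \<Delta> es \<ge> 3"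
    and "k < m_index \<Delta> es \<Longrightarrow>
      es (Suc k) / \<epsilon> \<le> normalized_bound p \<epsilon> \<Delta> es * (es k / \<epsilon>) powr (3 - 2 / p)"
proof -
  from assms(2) have sm: "strict_mono es" and pos: "\<And>k. es k > 0" and es0: "es 0 \<le> \<epsilon> / 2"
    and lim: "filterlim es at_top sequentially"
    by (auto simp: admissible_targets_def)
  have p: "2 / p \<le> 1" using assms by simp
  let ?t = "\<lambda>k. (1 + 2 * es (Suc k) / es k) * es k powr (2 / p - 2)"
  have term_le: "\<epsilon> powr (2 - 2 / p) * ?t k \<le> normalized_bound p \<epsilon> \<Delta> es" if "k < m_index \<Delta> es" for k
    unfolding normalized_bound_def using that pos
    by (intro mult_left_mono member_le_sum)
      (auto intro!: mult_nonneg_nonneg add_nonneg_nonneg simp: less_imp_le)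
  \<comment> \<open>The sum is not empty:
    \<open>es 0 \<le> \<epsilon> / 2 < \<Delta> / 2\<close>.\<close>
  have "0 < m_index \<Delta> es"
    using m_index_reached[OF lim, of \<Delta>] es0 assms by (cases "m_index \<Delta> es = 0") auto
  note first = term_le[OF this]
  have "3 * \<epsilon> powr (2 / p - 2) \<le> ?t 0"
  proof (rule mult_mono)
    have "es 0 < es 1" using sm by (simp add: strict_mono_less)
    then show "3 \<le> 1 + 2 * es (Suc 0) / es 0"
      using pos[of 0] by (simp add: field_simps)
    show "\<epsilon> powr (2 / p - 2) \<le> es 0 powr (2 / p - 2)"
      using pos[of 0] es0 assms p by (intro powr_mono2') linarith+
  qed (use pos[of 0] pos[of 1] in \<open>auto intro!: add_nonneg_nonneg less_imp_le\<close>)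
  then have "\<epsilon> powr (2 - 2 / p) * (3 * \<epsilon> powr (2 / p - 2)) \<le> normalized_bound p \<epsilon> \<Delta> es"
    by (rule order_trans[OF mult_left_mono first]) simp
  moreover have "\<epsilon> powr (2 - 2 / p) * \<epsilon> powr (2 / p - 2) = 1"
    using assms by (simp flip: powr_add)
  ultimately show "normalized_bound p \<epsilon> \<Delta> es \<ge> 3" by simp
  assume k: "k < m_index \<Delta> es"
  have "\<epsilon> powr (2 - 2 / p) * (es (Suc k) / es k * es k powr (2 / p - 2)) \<le>
      \<epsilon> powr (2 - 2 / p) * ?t k"
    using pos[of k] pos[of "Suc k"] by (intro mult_left_mono mult_right_mono) (auto simp: field_simps)
  also note term_le[OF k]
  finally have "\<epsilon> powr (2 - 2 / p) * (es (Suc k) / es k * es k powr (2 / p - 2)) * (es k / \<epsilon>) powr (3 - 2 / p)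
      \<le> normalized_bound p \<epsilon> \<Delta> es * (es k / \<epsilon>) powr (3 - 2 / p)"
    by (rule mult_right_mono) simp
  moreover have "\<epsilon> powr (2 - 2 / p) * (es (Suc k) / es k * es k powr (2 / p - 2)) * (es k / \<epsilon>) powr (3 - 2 / p)
      = es (Suc k) / \<epsilon>"
  proof -
    have "\<epsilon> powr (3 - 2 / p) = \<epsilon> * \<epsilon> powr (2 - 2 / p)"
      using assms powr_add[of \<epsilon> 1 "2 - 2 / p"] by simp
    moreover have "es k powr (2 / p - 2) * es k powr (3 - 2 / p) = es k"
      using pos[of k] by (simp flip: powr_add)
    ultimately show ?thesis
      using pos[of k] assms by (simp add: powr_divide field_simps)
  qed
  ultimately show "es (Suc k) / \<epsilon> \<le> normalized_bound p \<epsilon> \<Delta> es * (es k / \<epsilon>) powr (3 - 2 / p)"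
    by simp
qed

text \<open>In logarithms the recursion becomes affine with slope at most 3, so the targets need
  about \<open>log log\<close> many steps to climb from \<open>\<epsilon> / 2\<close> to
  \<open>\<Delta> / 2\<close>, unless the bound itself is large.\<close>

lemma ln_ln_le_normalized_bound:
  assumes "p \<ge> 2" "es \<in> admissible_targets \<epsilon>" "0 < \<epsilon>" "2 * \<epsilon> < \<Delta>"
  shows "ln (ln (\<Delta> / (2 * \<epsilon>))) \<le> 2 * (real (m_index \<Delta> es) + 1) * normalized_bound p \<epsilon> \<Delta> es"
proof -
  from assms(2) have pos: "\<And>k. es k > 0" and es0: "es 0 \<le> \<epsilon> / 2"
    and lim: "filterlim es at_top sequentially"
    by (auto simp: admissible_targets_def)
  define L where "L = normalized_bound p \<epsilon> \<Delta> es"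
  define m where "m = m_index \<Delta> es"
  have \<Delta>: "\<epsilon> < \<Delta>" using assms by simp
  have L: "L \<ge> 3" using normalized_bound_ge(1)[OF assms(1-3) \<Delta>] by (simp add: L_def)
  have lnL: "ln L > 0" using L by simp
  have p: "2 / p \<le> 1" "0 < 2 / p" using assms by simp_all
  \<comment> \<open>The factor \<open>(3 ^ k - 1) / 2\<close> solves
    \<open>a (k + 1) = 1 + 3 * a k\<close> with \<open>a 0 = 0\<close>.\<close>
  have growth: "ln (es k / \<epsilon>) \<le> (3 ^ k - 1) / 2 * ln L" if "k \<le> m" for k
    using that
  proof (induction k)
    case 0
    then show ?case using es0 pos[of 0] assms by (simp add: field_simps)
  next
    case (Suc k)
    have "ln (es (Suc k) / \<epsilon>) \<le> ln (L * (es k / \<epsilon>) powr (3 - 2 / p))"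
      using normalized_bound_ge(2)[OF assms(1-3) \<Delta>, of k] Suc.prems pos[of k] pos[of "Suc k"] L assms
      by (intro ln_mono) (auto simp: L_def m_def)
    also have "\<dots> = ln L + (3 - 2 / p) * ln (es k / \<epsilon>)"
      using L pos[of k] assms by (simp add: ln_mult ln_powr)
    also have "\<dots> \<le> ln L + (3 - 2 / p) * ((3 ^ k - 1) / 2 * ln L)"
      using Suc p by (intro add_left_mono mult_left_mono) linarith+
    also have "\<dots> \<le> ln L + 3 * ((3 ^ k - 1) / 2 * ln L)"
      using lnL p by (intro add_left_mono mult_right_mono) auto
    also have "\<dots> = (3 ^ Suc k - 1) / 2 * ln L" by (simp add: field_simps)
    finally show ?case .
  qed
  have "ln (\<Delta> / (2 * \<epsilon>)) \<le> ln (es m / \<epsilon>)"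
    using m_index_reached[OF lim, of \<Delta>] assms by (intro ln_mono) (auto simp: m_def field_simps)
  also have "\<dots> \<le> (3 ^ m - 1) / 2 * ln L" using growth by simp
  also have "\<dots> \<le> 3 ^ m * ln L" using lnL by (intro mult_right_mono) (auto simp: field_simps)
  finally have "ln (ln (\<Delta> / (2 * \<epsilon>))) \<le> ln (3 ^ m * ln L)"
    using assms by (intro ln_mono) auto
  also have "\<dots> = m * ln 3 + ln (ln L)"
    using lnL by (simp add: ln_mult ln_realpow)
  \<comment> \<open>Both logarithms are estimated crudely by \<open>2 * L\<close>, since the oracle
    bound contains \<open>L\<close> as a factor anyway.\<close>
  also have "\<dots> \<le> m * (2 * L) + 2 * L"
  proof (intro add_mono mult_left_mono)
    show "ln 3 \<le> 2 * L" using ln_le_minus_one[of 3] L by simp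
    show "ln (ln L) \<le> 2 * L" using ln_le_minus_one[of "ln L"] ln_le_minus_one[of L] L lnL by linarith
  qed simp
  finally show ?thesis by (simp add: L_def m_def algebra_simps)
qed

text \<open>The preceding estimate concerns \<open>\<Delta> / (2 * \<epsilon>)\<close>. Halving the
  argument lowers the iterated logarithm by at most \<open>ln 2 \<le> 1\<close>, which is at most
  half of its value beyond the threshold.\<close>

lemma ln_ln_le_double:
  fixes x :: real
  assumes "x \<ge> exp (exp 2)"
  shows "ln (ln x) \<ge> 2" "ln (ln x) \<le> 2 * ln (ln (x / 2))" "x > 2"
proof -
  have ex: "exp 2 \<ge> (3 :: real)" using exp_ge_add_one_self[of 2] by simp
  have "exp (exp 2) \<ge> 1 + exp (2::real)" by simp
  then show x: "x > 2" using ex assms by linarith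
  have l: "ln x \<ge> exp 2" using assms x by (metis exp_gt_zero ln_exp ln_mono)
  show ll: "ln (ln x) \<ge> 2" using l by (metis exp_gt_zero ln_exp ln_mono)
  have "ln x / 2 \<le> ln (x / 2)"
    using l ex x ln_le_minus_one[of 2] by (simp add: ln_div)
  then have "ln (ln x / 2) \<le> ln (ln (x / 2))" using l ex by (intro ln_mono) auto
  moreover have "ln (ln x / 2) = ln (ln x) - ln 2" using l ex by (simp add: ln_div)
  moreover have "ln 2 \<le> (1::real)" using ln_le_minus_one[of 2] by simp
  ultimately show "ln (ln x) \<le> 2 * ln (ln (x / 2))" using ll by linarith
qed

section \<open>One step of the subgradient method\<close>

lemma euclidean_subspace_imp_subspace: "euclidean_subspace d E \<Longrightarrow> subspace E"
  unfolding euclidean_subspace_def by auto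

lemma min_value_eq:
  assumes "xs \<in> minimizers E f"
  shows "xs \<in> E" "min_value E f = f xs" "x \<in> E \<Longrightarrow> min_value E f \<le> f x"
proof -
  from assms have xs: "xs \<in> E" "\<And>y. y \<in> E \<Longrightarrow> f xs \<le> f y"
    by (auto simp: minimizers_def is_arg_min_def not_less)
  then show "xs \<in> E" by simp
  show "min_value E f = f xs"
    unfolding min_value_def by (rule cInf_eq_minimum) (use xs in auto)
  then show "x \<in> E \<Longrightarrow> min_value E f \<le> f x" using xs by simp
qed

lemma norm_subgradient_le:
  assumes "subspace E" "M-lipschitz_on E f" "x \<in> E" "g \<in> subdifferential E f x"
  shows "norm g \<le> M"
proof (cases "g = 0")
  case True
  then show ?thesis using assms(2) by (simp add: lipschitz_on_nonneg)
next
  case False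
  have gE: "g \<in> E" "x + g \<in> E"
    using assms by (auto simp: subdifferential_def subspace_add)
  then have "f x + g \<bullet> (x + g - x) \<le> f (x + g)"
    using assms(4) by (simp only: subdifferential_def mem_Collect_eq)
  then have "(norm g)\<^sup>2 \<le> f (x + g) - f x" by (simp add: power2_norm_eq_inner[symmetric])
  also have "\<dots> \<le> M * norm g"
    using lipschitz_onD[OF assms(2) gE(2) assms(3)] by (simp add: dist_real_def dist_norm)
  finally show ?thesis using False by (simp add: power2_eq_square)
qed

lemma subgradient_step_in:
  assumes "subspace E" "x \<in> E" "subgradient_step E f e x y"
  shows "y \<in> E"
  using assms by (auto simp: subgradient_step_def subdifferential_def subspace_diff subspace_mul split: if_splits)

text \<open>Expanding the squared distance to a minimizer gives the classical decrease
  \<open>e * (2 * gap - e) / (norm g)\<^sup>2\<close>. The lower bound \<open>r\<close> of the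
  bracket is left free, so that it can later be the gap of a reference point.\<close>

lemma subgradient_step_infdist:
  assumes E: "subspace E" and lip: "M-lipschitz_on E f" and ne: "minimizers E f \<noteq> {}"
    and x: "x \<in> E" and step: "subgradient_step E f e x y"
    and e: "0 < e" and gap: "e < f x - min_value E f" and r: "r \<le> 2 * (f x - min_value E f) - e" "0 \<le> r"
  shows "(infdist y (minimizers E f))\<^sup>2 \<le> (infdist x (minimizers E f))\<^sup>2 - e * r / M\<^sup>2"
proof -
  let ?X = "minimizers E f"
  obtain g where g: "g \<in> subdifferential E f x" and y: "y = (if g = 0 then x else x - (e / (norm g)\<^sup>2) *\<^sub>R g)"
    using step by (auto simp: subgradient_step_def)
  have sub: "g \<bullet> (x - xs) \<ge> f x - min_value E f" if "xs \<in> ?X" for xs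
    using g min_value_eq[OF that] by (auto simp: subdifferential_def inner_diff_right dest!: bspec[of _ _ xs])
  obtain xs where xs: "xs \<in> ?X" using ne by blast
  \<comment> \<open>A zero subgradient would make \<open>x\<close> optimal, against the positive
    gap.\<close>
  have g0: "g \<noteq> 0" using sub[OF xs] gap e by auto
  have gM: "norm g \<le> M" by (rule norm_subgradient_le[OF E lip x g])
  define q where "q = e * r / M\<^sup>2"
  have q0: "q \<ge> 0" using e r by (simp add: q_def)
  \<comment> \<open>With the root taken, the right-hand side is the distance itself, and the infimum
    over \<open>xs\<close> can be formed without choosing a nearest minimizer.\<close>
  have "sqrt ((infdist y ?X)\<^sup>2 + q) \<le> dist x xs" if "xs \<in> ?X" for xs
  proof -
    define n where "n = (norm g)\<^sup>2"
    have n0: "n > 0" using g0 by (simp add: n_def)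
    have "y - xs = (x - xs) - (e / n) *\<^sub>R g"
      using g0 by (simp add: y n_def)
    then have "(dist y xs)\<^sup>2 = ((x - xs) - (e / n) *\<^sub>R g) \<bullet> ((x - xs) - (e / n) *\<^sub>R g)"
      by (simp only: dist_norm power2_norm_eq_inner)
    also have "\<dots> = (dist x xs)\<^sup>2 - 2 * (e / n) * (g \<bullet> (x - xs)) + (e / n)\<^sup>2 * n"
      unfolding dist_norm n_def power2_norm_eq_inner inner_diff_left[of "x - xs"]
        inner_diff_right[of _ "x - xs"] inner_scaleR_left inner_scaleR_right inner_commute[of "x - xs" g]
      by algebra
    also have "\<dots> = (dist x xs)\<^sup>2 - e * (2 * (g \<bullet> (x - xs)) - e) / n"
      using n0 by (simp add: power2_eq_square field_simps)
    also have "\<dots> \<le> (dist x xs)\<^sup>2 - e * r / n"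
      using sub[OF that] r e n0 by (intro diff_left_mono divide_right_mono mult_left_mono) auto
    also have "\<dots> \<le> (dist x xs)\<^sup>2 - q"
      unfolding q_def using e r n0 gM
      by (intro diff_left_mono divide_left_mono) (auto simp: n_def intro!: power_mono mult_pos_pos)
    finally have "(dist y xs)\<^sup>2 \<le> (dist x xs)\<^sup>2 - q" .
    moreover have "(infdist y ?X)\<^sup>2 \<le> (dist y xs)\<^sup>2"
      using that by (intro power_mono infdist_le infdist_nonneg)
    ultimately have "(infdist y ?X)\<^sup>2 + q \<le> (dist x xs)\<^sup>2" by simp
    then show ?thesis by (metis real_le_lsqrt zero_le_dist)
  qed
  then have "sqrt ((infdist y ?X)\<^sup>2 + q) \<le> infdist x ?X"
    unfolding infdist_def using ne by (auto intro!: cINF_greatest)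
  then have "(infdist y ?X)\<^sup>2 + q \<le> (infdist x ?X)\<^sup>2"
    using q0 sqrt_le_D by blast
  then show ?thesis by (simp add: q_def)
qed

text \<open>\<open>P\<close> persists forwards and \<open>Q\<close> backwards, so the rounds
  satisfying both form an interval. Along it the potential starts at most at \<open>V\<close>, drops
  by 1 per round and stays at least 1.\<close>

lemma card_le_of_decreasing_potential:
  fixes \<psi> :: "nat \<Rightarrow> real"
  assumes up: "\<And>t. P t \<Longrightarrow> P (Suc t)" and down: "\<And>t. Q (Suc t) \<Longrightarrow> Q t"
    and init: "\<And>t. P t \<Longrightarrow> Q t \<Longrightarrow> \<psi> t \<le> V"
    and pos: "\<And>t. P t \<Longrightarrow> Q t \<Longrightarrow> 1 \<le> \<psi> t"
    and dec: "\<And>t. P t \<Longrightarrow> Q t \<Longrightarrow> Q (Suc t) \<Longrightarrow> \<psi> (Suc t) \<le> \<psi> t - 1"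
    and "0 \<le> V"
  shows "finite {t. P t \<and> Q t} \<and> real (card {t. P t \<and> Q t}) \<le> V"
proof (cases "\<exists>t. P t \<and> Q t")
  case False
  then have e: "{t. P t \<and> Q t} = {}" by blast
  show ?thesis unfolding e using \<open>0 \<le> V\<close> by simp
next
  case True
  define a where "a = (LEAST t. P t \<and> Q t)"
  have a: "P a" "Q a" and a_le: "\<And>t. P t \<Longrightarrow> Q t \<Longrightarrow> a \<le> t"
    unfolding a_def using True by (blast intro: LeastI2_ex, blast intro: LeastI2_ex, blast intro: Least_le)
  have P: "P (a + j)" for j by (induction j) (auto simp: a up)
  have *: "\<psi> (a + j) \<le> V - j" if "Q (a + j)" for j
    using that
  proof (induction j)
    case 0
    then show ?case using a init by simp
  next
    case (Suc j)
    then have "Q (a + j)" using down by simp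
    then show ?case using Suc.IH dec[OF P, of j] Suc.prems by simp
  qed
  have sub: "{t. P t \<and> Q t} \<subseteq> {a..<a + nat \<lfloor>V\<rfloor>}"
  proof safe
    fix t assume t: "P t" "Q t"
    then obtain j where j: "t = a + j" using a_le le_Suc_ex by blast
    have "1 \<le> V - real j" using *[of j] pos[of t] t j by simp
    then show "t \<in> {a..<a + nat \<lfloor>V\<rfloor>}" unfolding j by (simp, linarith)
  qed
  have "card {t. P t \<and> Q t} \<le> nat \<lfloor>V\<rfloor>" using card_mono[OF _ sub] by simp
  then show ?thesis using finite_subset[OF sub] \<open>0 \<le> V\<close> by (simp, linarith)
qed

section \<open>Invariants of a run with arbitrary increasing targets\<close>

locale restart_run =
  fixes E :: "'a::real_inner set" and f :: "'a \<Rightarrow> real" and M \<mu> p :: real and x0 :: 'a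
    and es :: "nat \<Rightarrow> real" and S :: "nat \<Rightarrow> 'a scheme_state"
  assumes subspace: "subspace E" and lipschitz: "M-lipschitz_on E f"
    and minimizers_nonempty: "minimizers E f \<noteq> {}"
    and x0_in: "x0 \<in> E" and mu_pos: "\<mu> > 0" and p_ge: "p \<ge> 2"
    and growth: "\<And>x. x \<in> E \<Longrightarrow> f x \<le> f x0 \<Longrightarrow>
      f x - min_value E f \<ge> \<mu> * infdist x (minimizers E f) powr p"
    and es_pos: "\<And>k. es k > 0" and es_mono: "strict_mono es"
    and run: "scheme_run f (subgradient_step E f) es 1 x0 S"
    and x0_not_min: "f x0 > min_value E f"
begin

definition gap :: "'a \<Rightarrow> real" where
  "gap x = f x - min_value E f"

abbreviation idist :: "'a \<Rightarrow> real" where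
  "idist x \<equiv> infdist x (minimizers E f)"

text \<open>\<open>best\<close> is only the best iterate of one round, and a subgradient step may
  increase \<open>f\<close>; a running minimum is what decreases monotonically.\<close>

primrec low :: "nat \<Rightarrow> real" where
  "low 0 = gap (best (S 0))"
| "low (Suc t) = min (low t) (gap (best (S (Suc t))))"

lemma gap_nonneg: "x \<in> E \<Longrightarrow> 0 \<le> gap x"
  using minimizers_nonempty min_value_eq(3) by (fastforce simp: gap_def)

lemma M_pos: "M > 0"
proof -
  obtain xs where xs: "xs \<in> minimizers E f" using minimizers_nonempty by blast
  have "0 < dist (f x0) (f xs)" using x0_not_min min_value_eq(2)[OF xs] by simp
  also have "\<dots> \<le> M * dist x0 xs"
    by (rule lipschitz_onD[OF lipschitz x0_in min_value_eq(1)[OF xs]])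
  finally show ?thesis
    by (metis dist_commute mult_le_0_iff not_less zero_le_dist)
qed

lemma S_0: "S 0 = initial_state 1 x0"
  using run by (simp add: scheme_run_def)

lemma scheme_round_cases:
  obtains y where
    "\<And>k. k < nproc (S t) \<Longrightarrow> subgradient_step E f (es k) (iter (S t) k) (y k)"
    "\<exists>j<nproc (S t). best (S (Suc t)) = y j"
    "\<And>k. k < nproc (S t) \<Longrightarrow> f (best (S (Suc t))) \<le> f (y k)"
    "\<And>k. k < nproc (S t) \<Longrightarrow> accomplishes f es (S t) (best (S (Suc t))) k \<Longrightarrow>
       iter (S (Suc t)) k = best (S (Suc t)) \<and> refp (S (Suc t)) k = best (S (Suc t))"
    "\<And>k. k < nproc (S t) \<Longrightarrow> \<not> accomplishes f es (S t) (best (S (Suc t))) k \<Longrightarrow>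
       iter (S (Suc t)) k = y k \<and> refp (S (Suc t)) k = refp (S t) k"
    "accomplishes f es (S t) (best (S (Suc t))) (nproc (S t) - 1) \<Longrightarrow>
       nproc (S (Suc t)) = Suc (nproc (S t)) \<and> iter (S (Suc t)) (nproc (S t)) = best (S (Suc t)) \<and>
       refp (S (Suc t)) (nproc (S t)) = best (S (Suc t))"
    "\<not> accomplishes f es (S t) (best (S (Suc t))) (nproc (S t) - 1) \<Longrightarrow> nproc (S (Suc t)) = nproc (S t)"
proof -
  have "scheme_round f (subgradient_step E f) es (S t) (S (Suc t))"
    using run by (simp add: scheme_run_def)
  then obtain y where y: "\<forall>k<nproc (S t). subgradient_step E f (es k) (iter (S t) k) (y k)"
     "\<exists>j<nproc (S t). best (S (Suc t)) = y j \<and> (\<forall>k<nproc (S t). f (y j) \<le> f (y k))"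
     "\<forall>k<nproc (S t). if accomplishes f es (S t) (best (S (Suc t))) k
            then iter (S (Suc t)) k = best (S (Suc t)) \<and> refp (S (Suc t)) k = best (S (Suc t))
            else iter (S (Suc t)) k = y k \<and> refp (S (Suc t)) k = refp (S t) k"
     "if accomplishes f es (S t) (best (S (Suc t))) (nproc (S t) - 1)
      then nproc (S (Suc t)) = Suc (nproc (S t)) \<and> iter (S (Suc t)) (nproc (S t)) = best (S (Suc t)) \<and>
        refp (S (Suc t)) (nproc (S t)) = best (S (Suc t))
      else nproc (S (Suc t)) = nproc (S t)"
    unfolding scheme_round_def by blast
  show thesis
    by (rule that[of y]) (use y in \<open>auto split: if_splits\<close>)
qed

text \<open>The bound by \<open>f x0\<close> makes the growth condition applicable at the reference
  point. The bound by \<open>low t + es k\<close> expresses that no value seen so far undercuts the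
  reference by more than \<open>es k\<close>.\<close>

definition proper_process :: "nat \<Rightarrow> nat \<Rightarrow> bool" where
  "proper_process t k \<longleftrightarrow>
     iter (S t) k \<in> E \<and> refp (S t) k \<in> E \<and> f (refp (S t) k) \<le> f x0 \<and>
     low t \<le> gap (iter (S t) k) \<and> low t \<le> gap (refp (S t) k) \<and> gap (refp (S t) k) \<le> low t + es k \<and>
     (2 * es k \<le> low t \<longrightarrow> idist (iter (S t) k) \<le> idist (refp (S t) k))"

lemma proper_process_best:
  assumes "best (S t) \<in> E" "f (best (S t)) \<le> f x0" "low t = gap (best (S t))"
    "iter (S t) k = best (S t)" "refp (S t) k = best (S t)"
  shows "proper_process t k"
  using assms es_pos[of k] by (simp add: proper_process_def)

text \<open>Here the threshold \<open>2 * es k\<close> originates: the reference gap is at most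
  \<open>low t + es k\<close>, hence at most \<open>2 * low t - es k\<close>, and the gap of the
  iterate is at least \<open>low t\<close>.\<close>

lemma step_infdist:
  assumes "proper_process t k" "2 * es k \<le> low t" "subgradient_step E f (es k) (iter (S t) k) y"
  shows "(idist y)\<^sup>2 \<le> (idist (iter (S t) k))\<^sup>2 - es k * gap (refp (S t) k) / M\<^sup>2"
  using assms es_pos[of k] gap_nonneg[of "refp (S t) k"]
  by (intro subgradient_step_infdist[OF subspace lipschitz minimizers_nonempty])
    (auto simp: proper_process_def gap_def)

lemma invariant:
  "1 \<le> nproc (S t) \<and> best (S t) \<in> E \<and> low t \<le> gap x0 \<and> (\<forall>k<nproc (S t). proper_process t k)"
proof (induction t)
  case 0
  then show ?case
    by (auto simp: S_0 initial_state_def x0_in intro!: proper_process_best)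
next
  case (Suc t)
  obtain y where y:
    "\<And>k. k < nproc (S t) \<Longrightarrow> subgradient_step E f (es k) (iter (S t) k) (y k)"
    "\<exists>j<nproc (S t). best (S (Suc t)) = y j"
    "\<And>k. k < nproc (S t) \<Longrightarrow> f (best (S (Suc t))) \<le> f (y k)"
    "\<And>k. k < nproc (S t) \<Longrightarrow> accomplishes f es (S t) (best (S (Suc t))) k \<Longrightarrow>
       iter (S (Suc t)) k = best (S (Suc t)) \<and> refp (S (Suc t)) k = best (S (Suc t))"
    "\<And>k. k < nproc (S t) \<Longrightarrow> \<not> accomplishes f es (S t) (best (S (Suc t))) k \<Longrightarrow>
       iter (S (Suc t)) k = y k \<and> refp (S (Suc t)) k = refp (S t) k"
    "accomplishes f es (S t) (best (S (Suc t))) (nproc (S t) - 1) \<Longrightarrow>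
       nproc (S (Suc t)) = Suc (nproc (S t)) \<and> iter (S (Suc t)) (nproc (S t)) = best (S (Suc t)) \<and>
       refp (S (Suc t)) (nproc (S t)) = best (S (Suc t))"
    "\<not> accomplishes f es (S t) (best (S (Suc t))) (nproc (S t) - 1) \<Longrightarrow>
       nproc (S (Suc t)) = nproc (S t)"
    by (fact scheme_round_cases)
  let ?b = "best (S (Suc t))"
  have IH: "proper_process t k" if "k < nproc (S t)" for k using Suc.IH that by blast
  have yE: "y k \<in> E" if "k < nproc (S t)" for k
    using subgradient_step_in[OF subspace _ y(1)[OF that]] IH[OF that] by (simp add: proper_process_def)
  then have bE: "?b \<in> E" using y(2) by auto
  have np: "1 \<le> nproc (S (Suc t))" using Suc.IH y(6,7)
    by (cases "accomplishes f es (S t) ?b (nproc (S t) - 1)") auto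
  \<comment> \<open>The reference gap is at most \<open>low t + es k\<close>, so a point that
    accomplishes the task is at least as good as everything seen before. A restart therefore always
    happens at a point attaining the new \<open>low\<close>.\<close>
  have success: "f ?b \<le> f x0 \<and> low (Suc t) = gap ?b"
    if "k < nproc (S t)" "accomplishes f es (S t) ?b k" for k
    using IH[OF that(1)] that(2) es_pos[of k]
    by (auto simp: proper_process_def accomplishes_def gap_def)
  have "proper_process (Suc t) k" if k: "k < nproc (S (Suc t))" for k
  proof (cases "k < nproc (S t)")
    case True
    show ?thesis
    proof (cases "accomplishes f es (S t) ?b k")
      case acc: True
      show ?thesis
        using success[OF True acc] y(4)[OF True acc] bE by (intro proper_process_best) auto
    next
      case False
      \<comment> \<open>The failed task is exactly what preserves the upper bound on the reference
        gap.\<close>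
      have r: "gap (refp (S t) k) < gap ?b + es k" using False by (auto simp: accomplishes_def gap_def)
      have i: "idist (y k) \<le> idist (refp (S t) k)" if "2 * es k \<le> low (Suc t)"
      proof -
        have l: "2 * es k \<le> low t" using that by simp
        have "(idist (y k))\<^sup>2 \<le> (idist (iter (S t) k))\<^sup>2"
          using step_infdist[OF IH[OF True] l y(1)[OF True]] es_pos[of k] gap_nonneg[of "refp (S t) k"] IH[OF True]
          by (smt (verit) divide_nonneg_nonneg mult_nonneg_nonneg proper_process_def zero_le_power2)
        then have "idist (y k) \<le> idist (iter (S t) k)"
          by (rule power2_le_imp_le) (rule infdist_nonneg)
        then show ?thesis using IH[OF True] l by (simp add: proper_process_def)
      qed
      show ?thesis
        using IH[OF True] y(5)[OF True False] yE[OF True] y(3)[OF True] r i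
        by (auto simp: proper_process_def gap_def)
    qed
  next
    case False
    then have acc: "accomplishes f es (S t) ?b (nproc (S t) - 1)" and kk: "k = nproc (S t)"
      using k y(6,7) by (metis less_SucE)+
    have "nproc (S t) - 1 < nproc (S t)" using Suc.IH by simp
    from success[OF this acc] show ?thesis
      using y(6)[OF acc] kk bE by (intro proper_process_best) auto
  qed
  then show ?case using np bE Suc.IH by auto
qed

lemma nproc_mono: "nproc (S t) \<le> nproc (S (Suc t))"
  by (rule scheme_round_cases[of t]) (metis le_refl le_SucI)

text \<open>Process \<open>k + 1\<close> is launched only when process \<open>k\<close> accomplishes
  its task, that is, lowers a gap of at most \<open>gap x0\<close> by \<open>es k\<close> to a
  nonnegative one.\<close>

lemma es_le_gap_if_nproc: "Suc k < nproc (S t) \<Longrightarrow> es k \<le> gap x0"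
proof (induction t)
  case 0
  then show ?case by (simp add: S_0 initial_state_def)
next
  case (Suc t)
  show ?case
  proof (cases "accomplishes f es (S t) (best (S (Suc t))) (nproc (S t) - 1)")
    case True
    have "nproc (S (Suc t)) = Suc (nproc (S t))"
      using True by (rule_tac scheme_round_cases[of t]) blast
    then have k: "Suc k < nproc (S t) \<or> k = nproc (S t) - 1" using Suc.prems by auto
    have "proper_process t (nproc (S t) - 1)" using invariant[of t] by simp
    then have "es (nproc (S t) - 1) \<le> gap x0"
      using True gap_nonneg[of "best (S (Suc t))"] invariant[of "Suc t"]
      by (auto simp: accomplishes_def gap_def proper_process_def)
    then show ?thesis using k Suc.IH by blast
  next
    case False
    have "nproc (S (Suc t)) = nproc (S t)"
      using False by (rule_tac scheme_round_cases[of t]) blast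
    then show ?thesis using Suc by simp
  qed
qed

section \<open>Potentials and the number of rounds charged to each process\<close>

text \<open>This is \<open>w\<^sub>k\<close> of the overview.\<close>

definition work :: "nat \<Rightarrow> real" where
  "work k = M\<^sup>2 / \<mu> powr (2 / p) * es k powr (2 / p - 2)"

text \<open>The squared distance to the minimizers in units of the decrease that
  \<open>step_infdist\<close> guarantees per round.\<close>

definition run_potential :: "nat \<Rightarrow> nat \<Rightarrow> real" where
  "run_potential k t = M\<^sup>2 * (idist (iter (S t) k))\<^sup>2 / (es k * gap (refp (S t) k))"

text \<open>The second summand pays for the value \<open>work k\<close> to which each restart may reset the first one.\<close>

definition total_potential :: "nat \<Rightarrow> nat \<Rightarrow> real" where
  "total_potential k t = run_potential k t + work k * (gap (refp (S t) k) / es k)"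

lemma work_nonneg: "0 \<le> work k"
  by (simp add: work_def)

text \<open>The growth condition at the reference point, with gap \<open>r\<close>, bounds the
  squared distance by \<open>(r / \<mu>) powr (2 / p)\<close>. Division by \<open>r\<close> leaves
  the exponent \<open>2 / p - 1\<close>, nonpositive as \<open>p \<ge> 2\<close>, so
  \<open>r\<close> may be replaced by the smaller \<open>es k\<close>.\<close>

lemma run_potential_le:
  assumes k: "k < nproc (S t)" and l: "2 * es k \<le> low t"
  shows "run_potential k t \<le> work k"
proof -
  define r where "r = gap (refp (S t) k)"
  have pr: "proper_process t k" using invariant[of t] k by blast
  have r: "es k \<le> r" "0 < r" using pr l es_pos[of k] by (auto simp: proper_process_def r_def)
  have "\<mu> * idist (refp (S t) k) powr p \<le> r"
    using growth[of "refp (S t) k"] pr by (simp add: proper_process_def r_def gap_def)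
  then have "idist (refp (S t) k) powr p \<le> r / \<mu>" using mu_pos by (simp add: field_simps)
  then have "(idist (refp (S t) k) powr p) powr (2 / p) \<le> (r / \<mu>) powr (2 / p)"
    using p_ge by (intro powr_mono2) auto
  then have "(idist (refp (S t) k))\<^sup>2 \<le> (r / \<mu>) powr (2 / p)"
    using p_ge by (simp add: powr_powr infdist_nonneg)
  moreover have "(idist (iter (S t) k))\<^sup>2 \<le> (idist (refp (S t) k))\<^sup>2"
    using pr l by (intro power_mono) (auto simp: proper_process_def infdist_nonneg)
  ultimately have d: "(idist (iter (S t) k))\<^sup>2 \<le> r powr (2 / p) / \<mu> powr (2 / p)"
    using r mu_pos by (simp add: powr_divide)
  have "run_potential k t \<le> M\<^sup>2 * (r powr (2 / p) / \<mu> powr (2 / p)) / (es k * r)"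
    unfolding run_potential_def r_def[symmetric] using d r es_pos[of k]
    by (intro divide_right_mono mult_left_mono) auto
  also have "\<dots> = M\<^sup>2 / \<mu> powr (2 / p) * (r powr (2 / p - 1) / es k)"
    using r by (simp add: powr_diff field_simps)
  also have "\<dots> \<le> M\<^sup>2 / \<mu> powr (2 / p) * (es k powr (2 / p - 1) / es k)"
    using r p_ge es_pos[of k] by (intro mult_left_mono divide_right_mono powr_mono2') auto
  also have "es k powr (2 / p - 1) / es k = es k powr (2 / p - 2)"
    using es_pos[of k] powr_diff[of "es k" "2 / p - 1" 1] by simp
  finally show ?thesis by (simp add: work_def)
qed

text \<open>A round without restart consumes one unit of squared distance. A restart instead lowers
  the reference gap by at least \<open>es k\<close>, which releases \<open>work k\<close> in the
  total potential.\<close>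

lemma potentials:
  assumes k: "k < nproc (S t)" and l: "2 * es k \<le> low t"
  shows "1 \<le> run_potential k t" "1 \<le> total_potential k t"
    and "nproc (S (Suc t)) \<le> Suc k \<Longrightarrow> run_potential k (Suc t) \<le> run_potential k t - 1"
    and "2 * es k \<le> low (Suc t) \<Longrightarrow> total_potential k (Suc t) \<le> total_potential k t - 1"
proof -
  obtain y where y:
    "\<And>k. k < nproc (S t) \<Longrightarrow> subgradient_step E f (es k) (iter (S t) k) (y k)"
    "\<And>k. k < nproc (S t) \<Longrightarrow> accomplishes f es (S t) (best (S (Suc t))) k \<Longrightarrow>
       iter (S (Suc t)) k = best (S (Suc t)) \<and> refp (S (Suc t)) k = best (S (Suc t))"
    "\<And>k. k < nproc (S t) \<Longrightarrow> \<not> accomplishes f es (S t) (best (S (Suc t))) k \<Longrightarrow>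
       iter (S (Suc t)) k = y k \<and> refp (S (Suc t)) k = refp (S t) k"
    "accomplishes f es (S t) (best (S (Suc t))) (nproc (S t) - 1) \<Longrightarrow>
       nproc (S (Suc t)) = Suc (nproc (S t))"
    by (rule scheme_round_cases[of t]) blast
  have pr: "proper_process t k" using invariant[of t] k by blast
  define r where "r = gap (refp (S t) k)"
  have r: "0 < r" using pr l es_pos[of k] by (auto simp: proper_process_def r_def)
  define q where "q = es k * r / M\<^sup>2"
  have q: "q > 0" using r es_pos[of k] M_pos by (simp add: q_def)
  have step: "(idist (y k))\<^sup>2 \<le> (idist (iter (S t) k))\<^sup>2 - q"
    unfolding q_def r_def by (rule step_infdist[OF pr l y(1)[OF k]])
  have run_eq: "run_potential k t = (idist (iter (S t) k))\<^sup>2 / q"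
    using M_pos by (simp add: run_potential_def q_def r_def field_simps)
  \<comment> \<open>The squared distance after the step is nonnegative, so the one before it is at
    least \<open>q\<close>.\<close>
  show run1: "1 \<le> run_potential k t"
    using step q by (simp add: run_eq) (smt (verit) zero_le_power2)
  then show "1 \<le> total_potential k t"
    using r es_pos[of k] work_nonneg[of k] by (simp add: total_potential_def r_def add_increasing2)
  have continue: "run_potential k (Suc t) \<le> run_potential k t - 1"
    if "\<not> accomplishes f es (S t) (best (S (Suc t))) k"
  proof -
    have "run_potential k (Suc t) = (idist (y k))\<^sup>2 / q"
      using M_pos y(3)[OF k that] by (simp add: run_potential_def q_def r_def field_simps)
    also have "\<dots> \<le> ((idist (iter (S t) k))\<^sup>2 - q) / q"
      using step q by (intro divide_right_mono) auto
    finally show ?thesis using q by (simp add: run_eq diff_divide_distrib)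
  qed
  show "run_potential k (Suc t) \<le> run_potential k t - 1" if "nproc (S (Suc t)) \<le> Suc k"
  proof (rule continue)
    show "\<not> accomplishes f es (S t) (best (S (Suc t))) k"
    proof
      assume acc: "accomplishes f es (S t) (best (S (Suc t))) k"
      \<comment> \<open>Process \<open>k\<close> is then the newest one, and its success would have
        launched process \<open>k + 1\<close>.\<close>
      have "k = nproc (S t) - 1" using k that nproc_mono[of t] by simp
      then show False using y(4) acc that k by simp
    qed
  qed
  show "total_potential k (Suc t) \<le> total_potential k t - 1" if l': "2 * es k \<le> low (Suc t)"
  proof (cases "accomplishes f es (S t) (best (S (Suc t))) k")
    case True
    have "run_potential k (Suc t) \<le> work k"
      using k nproc_mono[of t] l' by (intro run_potential_le) auto
    moreover have "gap (refp (S (Suc t)) k) / es k \<le> r / es k - 1"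
      using True y(2)[OF k True] es_pos[of k] by (simp add: accomplishes_def gap_def r_def field_simps)
    then have "work k * (gap (refp (S (Suc t)) k) / es k) \<le> work k * (r / es k - 1)"
      by (rule mult_left_mono) (rule work_nonneg)
    \<comment> \<open>The released \<open>work k\<close> covers the new first summand; the drop by 1
      comes from the old one, which was at least 1.\<close>
    ultimately show ?thesis
      using run1 by (simp add: total_potential_def r_def algebra_simps)
  next
    case False
    then show ?thesis using continue y(3)[OF k False] by (simp add: total_potential_def)
  qed
qed

text \<open>In this set and the next, the conjunctions are bracketed as a condition that persists
  forwards and one that persists backwards, as \<open>card_le_of_decreasing_potential\<close>
  requires.\<close>

definition launch_rounds :: "nat \<Rightarrow> nat set" where
  "launch_rounds k = {t. k < nproc (S t) \<and> (nproc (S t) \<le> Suc k \<and> 2 * es k \<le> low t)}"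

definition descent_rounds :: "nat \<Rightarrow> nat set" where
  "descent_rounds k = {t. (k < nproc (S t) \<and> low t < 2 * es (Suc k)) \<and> 2 * es k \<le> low t}"

lemma launch_rounds: "finite (launch_rounds k) \<and> real (card (launch_rounds k)) \<le> work k"
  unfolding launch_rounds_def
proof (rule card_le_of_decreasing_potential[where \<psi> = "run_potential k"])
  fix t
  show "k < nproc (S (Suc t))" if "k < nproc (S t)" using that nproc_mono[of t] by simp
  show "nproc (S t) \<le> Suc k \<and> 2 * es k \<le> low t"
    if "nproc (S (Suc t)) \<le> Suc k \<and> 2 * es k \<le> low (Suc t)"
    using that nproc_mono[of t] by simp
qed (auto intro: run_potential_le potentials work_nonneg)

text \<open>In these rounds the reference gap is at most \<open>low t + es k\<close>, so the second
  summand of the total potential is at most \<open>work k * (1 + 2 * es (Suc k) / es k)\<close>; the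
  first adds one more \<open>work k\<close>.\<close>

lemma descent_rounds:
  "finite (descent_rounds k) \<and>
   real (card (descent_rounds k)) \<le> work k * (2 + 2 * es (Suc k) / es k)"
  unfolding descent_rounds_def
proof (rule card_le_of_decreasing_potential[where \<psi> = "total_potential k"])
  fix t
  show "k < nproc (S (Suc t)) \<and> low (Suc t) < 2 * es (Suc k)" if "k < nproc (S t) \<and> low t < 2 * es (Suc k)"
    using that nproc_mono[of t] by auto
  show "2 * es k \<le> low t" if "2 * es k \<le> low (Suc t)" using that by simp
  assume t: "k < nproc (S t) \<and> low t < 2 * es (Suc k)" "2 * es k \<le> low t"
  then have "gap (refp (S t) k) / es k \<le> 1 + 2 * es (Suc k) / es k"
    using invariant[of t] es_pos[of k] by (auto simp: proper_process_def field_simps)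
  then have "work k * (gap (refp (S t) k) / es k) \<le> work k * (1 + 2 * es (Suc k) / es k)"
    by (rule mult_left_mono) (rule work_nonneg)
  then show "total_potential k t \<le> work k * (2 + 2 * es (Suc k) / es k)"
    using run_potential_le[of k t] t by (simp add: total_potential_def algebra_simps)
qed (use es_pos work_nonneg in \<open>auto intro: potentials simp: less_imp_le\<close>)

lemma round_covered:
  assumes "2 * es 0 \<le> low t" and m: "low t < 2 * es m"
  shows "\<exists>k<m. t \<in> launch_rounds k \<union> descent_rounds k"
proof -
  let ?P = "\<lambda>k. k < nproc (S t) \<and> 2 * es k \<le> low t"
  define k where "k = (GREATEST k. ?P k)"
  have "?P 0" using assms invariant[of t] by simp
  moreover have "\<forall>j. ?P j \<longrightarrow> j \<le> nproc (S t)" by simp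
  ultimately have k: "?P k" and max: "\<And>j. ?P j \<Longrightarrow> j \<le> k"
    unfolding k_def by (metis (no_types, lifting) GreatestI_nat, metis (no_types, lifting) Greatest_le_nat)
  \<comment> \<open>Either process \<open>Suc k\<close> does not exist yet or
    \<open>low t < 2 * es (Suc k)\<close>; these are the two kinds of rounds.\<close>
  have "\<not> ?P (Suc k)" using max[of "Suc k"] by auto
  then have "t \<in> launch_rounds k \<union> descent_rounds k"
    using k by (auto simp: launch_rounds_def descent_rounds_def)
  moreover have "k < m"
  proof (rule ccontr)
    assume "\<not> k < m"
    then have "es m \<le> es k" using es_mono by (simp add: strict_mono_less_eq)
    then show False using k m by simp
  qed
  ultimately show ?thesis by blast
qed

text \<open>The set \<open>A\<close> is arbitrary so that one count serves twice: with all rounds it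
  proves termination by contradiction, with an initial segment it bounds the complexity.\<close>

lemma rounds_before_low:
  assumes m: "gap x0 < 2 * es m" and A: "\<And>t. t \<in> A \<Longrightarrow> 2 * es 0 \<le> low t"
  shows "finite A" "real (card A) \<le> (\<Sum>k<m. 5 * (work k * (es (Suc k) / es k)))"
proof -
  let ?R = "\<lambda>k. launch_rounds k \<union> descent_rounds k"
  have fin: "finite (\<Union>k<m. ?R k)" using launch_rounds descent_rounds by blast
  have sub: "A \<subseteq> (\<Union>k<m. ?R k)"
  proof
    fix t assume "t \<in> A"
    moreover have "low t < 2 * es m" using invariant[of t] m by simp
    ultimately show "t \<in> (\<Union>k<m. ?R k)" using round_covered[OF A] by blast
  qed
  show "finite A" using sub fin by (rule finite_subset)
  have "card A \<le> card (\<Union>k<m. ?R k)" using fin sub by (rule card_mono)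
  also have "\<dots> \<le> (\<Sum>k<m. card (?R k))" by (rule card_UN_le) simp
  finally have "real (card A) \<le> (\<Sum>k<m. real (card (?R k)))" by (simp flip: of_nat_sum)
  also have "\<dots> \<le> (\<Sum>k<m. 5 * (work k * (es (Suc k) / es k)))"
  proof (rule sum_mono)
    fix k
    have "real (card (?R k)) \<le> work k + work k * (2 + 2 * es (Suc k) / es k)"
      using card_Un_le[of "launch_rounds k" "descent_rounds k"] launch_rounds[of k] descent_rounds[of k]
      by linarith
    also have "\<dots> = work k * (3 + 2 * (es (Suc k) / es k))" by (simp add: algebra_simps)
    \<comment> \<open>The ratio of successive targets exceeds 1, so it absorbs the constant
      3.\<close>
    also have "\<dots> \<le> work k * (5 * (es (Suc k) / es k))"
      using strict_monoD[OF es_mono, of k "Suc k"] es_pos[of k] work_nonneg[of k]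
      by (intro mult_left_mono) (auto simp: field_simps)
    finally show "real (card (?R k)) \<le> 5 * (work k * (es (Suc k) / es k))"
      by (simp add: mult.left_commute)
  qed
  finally show "real (card A) \<le> (\<Sum>k<m. 5 * (work k * (es (Suc k) / es k)))" .
qed

lemma low_ge: "(\<And>s. s \<le> t \<Longrightarrow> b \<le> gap (best (S s))) \<Longrightarrow> b \<le> low t"
  by (induction t) auto

lemma eps_optimal_reached:
  assumes m: "gap x0 < 2 * es m" and \<epsilon>: "2 * es 0 \<le> \<epsilon>"
  shows "\<exists>t. eps_optimal E f \<epsilon> (best (S t))"
    and "real (iteration_complexity E f \<epsilon> S) \<le> (\<Sum>k<m. 5 * (work k * (es (Suc k) / es k)))"
proof -
  \<comment> \<open>Before \<open>\<epsilon>\<close>-optimality all gaps exceed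
    \<open>\<epsilon> \<ge> 2 * es 0\<close>, so process 0 can always be charged.\<close>
  have low: "2 * es 0 \<le> low t" if "\<And>s. s \<le> t \<Longrightarrow> \<not> eps_optimal E f \<epsilon> (best (S s))" for t
    using that \<epsilon> by (intro low_ge) (smt (verit, best) eps_optimal_def gap_def)
  show "\<exists>t. eps_optimal E f \<epsilon> (best (S t))"
  proof (rule ccontr)
    assume "\<not> ?thesis"
    then have "finite (UNIV :: nat set)" using low by (intro rounds_before_low(1)[OF m]) auto
    then show False by simp
  qed
  have "2 * es 0 \<le> low t" if "t \<in> {..<iteration_complexity E f \<epsilon> S}" for t
  proof (rule low)
    fix s assume "s \<le> t"
    then have "s < (LEAST t. eps_optimal E f \<epsilon> (best (S t)))"
      using that by (simp add: iteration_complexity_def)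
    then show "\<not> eps_optimal E f \<epsilon> (best (S s))" by (rule not_less_Least)
  qed
  from rounds_before_low(2)[OF m this, of "{..<iteration_complexity E f \<epsilon> S}"]
  show "real (iteration_complexity E f \<epsilon> S) \<le> (\<Sum>k<m. 5 * (work k * (es (Suc k) / es k)))"
    by simp
qed

end

section \<open>Complexities for the exponential targets\<close>

text \<open>By Bernoulli's inequality \<open>c ^ k\<close> is at least \<open>k * (c - 1)\<close>,
  so a geometric series dominates.\<close>

lemma summable_exp_minus_power:
  fixes c \<gamma> :: real
  assumes "1 < c" "0 < \<gamma>"
  shows "summable (\<lambda>k. exp (- \<gamma> * c ^ k))"
proof (rule summable_comparison_test)
  have "exp (- \<gamma> * c ^ k) \<le> exp (- \<gamma> * (c - 1)) ^ k" for k
  proof -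
    have "\<gamma> * (real k * (c - 1)) \<le> \<gamma> * c ^ k"
      using Bernoulli_inequality[of "c - 1" k] assms by (intro mult_left_mono) auto
    then show ?thesis by (simp add: algebra_simps flip: exp_of_nat_mult)
  qed
  then show "\<exists>N. \<forall>k\<ge>N. norm (exp (- \<gamma> * c ^ k)) \<le> exp (- \<gamma> * (c - 1)) ^ k" by simp
  show "summable (\<lambda>k. exp (- \<gamma> * (c - 1)) ^ k)"
    using assms by simp
qed

text \<open>The 5 comes from \<open>rounds_before_low\<close>, the power of \<open>2 * exp 1\<close>
  from the normalization of the targets.\<close>

definition exp_targets_const :: "real \<Rightarrow> real \<Rightarrow> real" where
  "exp_targets_const p c = 5 * (2 * exp 1) powr (2 - 2 / p) * (\<Sum>k. exp (- (3 - 2 / p - c) * c ^ k))"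

lemma exp_targets_const_pos:
  assumes "1 < c" "c < 3 - 2 / p"
  shows "0 < exp_targets_const p c"
  unfolding exp_targets_const_def
  using assms by (intro mult_pos_pos suminf_pos summable_exp_minus_power) auto

locale exp_restart_run = restart_run E f M \<mu> p x0 "exp_targets \<epsilon> c" S
  for E :: "'a::real_inner set" and f M \<mu> p x0 \<epsilon> c S +
  assumes eps_pos: "0 < \<epsilon>" and c_gt_1: "1 < c" and c_less: "c < 3 - 2 / p"
begin

text \<open>The power in \<open>work k\<close> contributes \<open>(2 / p - 2) * c ^ k\<close> to the
  exponent and the ratio of targets \<open>(c - 1) * c ^ k\<close>. Their sum is negative exactly
  when \<open>c < 3 - 2 / p\<close>.\<close>

lemma work_mult_ratio:
  "work k * (exp_targets \<epsilon> c (Suc k) / exp_targets \<epsilon> c k) =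
    iteration_rate M \<mu> p \<epsilon> * ((2 * exp 1) powr (2 - 2 / p) * exp (- (3 - 2 / p - c) * c ^ k))"
proof -
  have ratio: "exp_targets \<epsilon> c (Suc k) / exp_targets \<epsilon> c k = exp (c * c ^ k - c ^ k)"
    using eps_pos by (simp add: exp_targets_def exp_diff)
  have "exp_targets \<epsilon> c k powr (2 / p - 2) =
      (\<epsilon> / (2 * exp 1)) powr (2 / p - 2) * exp ((2 / p - 2) * c ^ k)"
    using eps_pos
    unfolding exp_targets_def by (simp add: powr_mult powr_def[of "exp _"] del: times_divide_eq_left)
  also have "(\<epsilon> / (2 * exp 1)) powr (2 / p - 2) = (2 * exp 1) powr (2 - 2 / p) * (1 / \<epsilon> powr (2 - 2 / p))"
    using eps_pos powr_minus[of "\<epsilon> / (2 * exp 1)" "2 - 2 / p"] by (simp add: powr_divide)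
  finally have pow: "exp_targets \<epsilon> c k powr (2 / p - 2) =
      (2 * exp 1) powr (2 - 2 / p) * (1 / \<epsilon> powr (2 - 2 / p)) * exp ((2 / p - 2) * c ^ k)" .
  have "exp ((2 / p - 2) * c ^ k) * exp (c * c ^ k - c ^ k) = exp (- (3 - 2 / p - c) * c ^ k)"
    unfolding exp_add[symmetric] by (simp add: algebra_simps)
  then show ?thesis
    unfolding work_def iteration_rate_def ratio pow by (simp only: mult.assoc mult.left_commute)
qed

lemma gap_bounded_by_target: "\<exists>m. gap x0 < 2 * exp_targets \<epsilon> c m"
proof -
  have "filterlim (exp_targets \<epsilon> c) at_top sequentially"
    using exp_targets_admissible[OF eps_pos c_gt_1] by (simp add: admissible_targets_def)
  from m_index_reached[OF this, of "2 * gap x0"] x0_not_min show ?thesis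
    by (intro exI[of _ "m_index (2 * gap x0) (exp_targets \<epsilon> c)"]) (simp add: gap_def)
qed

lemma
  shows exists_eps_optimal: "\<exists>t. eps_optimal E f \<epsilon> (best (S t))"
    and iteration_complexity_le:
      "real (iteration_complexity E f \<epsilon> S) \<le> exp_targets_const p c * iteration_rate M \<mu> p \<epsilon>"
proof -
  obtain m where m: "gap x0 < 2 * exp_targets \<epsilon> c m" using gap_bounded_by_target by blast
  have e0: "2 * exp_targets \<epsilon> c 0 \<le> \<epsilon>" by (simp add: exp_targets_def)
  show "\<exists>t. eps_optimal E f \<epsilon> (best (S t))" by (rule eps_optimal_reached(1)[OF m e0])
  let ?R = "5 * iteration_rate M \<mu> p \<epsilon> * (2 * exp 1) powr (2 - 2 / p)"
  have "real (iteration_complexity E f \<epsilon> S) \<le> (\<Sum>k<m. 5 * (work k * (exp_targets \<epsilon> c (Suc k) / exp_targets \<epsilon> c k)))"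
    by (rule eps_optimal_reached(2)[OF m e0])
  also have "\<dots> = ?R * (\<Sum>k<m. exp (- (3 - 2 / p - c) * c ^ k))"
    unfolding work_mult_ratio sum_distrib_left by (simp only: mult.assoc)
  also have "\<dots> \<le> ?R * (\<Sum>k. exp (- (3 - 2 / p - c) * c ^ k))"
    using c_gt_1 c_less
    by (intro mult_left_mono sum_le_suminf summable_exp_minus_power) (auto simp: iteration_rate_def)
  also have "\<dots> = exp_targets_const p c * iteration_rate M \<mu> p \<epsilon>"
    by (simp add: exp_targets_const_def)
  finally show "real (iteration_complexity E f \<epsilon> S) \<le> exp_targets_const p c * iteration_rate M \<mu> p \<epsilon>" .
qed

text \<open>The next-to-last process has a target of at most \<open>gap x0\<close>; two logarithms
  turn this into a linear bound on its index. The threshold on \<open>gap x0 / \<epsilon>\<close>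
  lets additive constants be absorbed into the iterated logarithm.\<close>

lemma nproc_le:
  assumes "gap x0 / \<epsilon> \<ge> exp (exp 2)"
  shows "real (nproc (S t)) \<le> (1 + 2 / ln c) * ln (ln (gap x0 / \<epsilon>))"
proof -
  define l where "l = ln (ln (gap x0 / \<epsilon>))"
  have l: "2 \<le> l" using ln_ln_le_double[OF assms] by (simp add: l_def)
  have ratio: "0 < gap x0 / \<epsilon>" using x0_not_min eps_pos by (simp add: gap_def)
  have big: "1 \<le> ln (gap x0 / \<epsilon>)"
    using ln_ge_iff[OF ratio, of "exp 2"] assms exp_ge_add_one_self[of "2::real"] by linarith
  have lnc: "0 < ln c" using c_gt_1 by simp
  have "0 \<le> 2 / ln c * l" using lnc l by simp
  then have two: "2 \<le> (1 + 2 / ln c) * l" using l by (simp add: algebra_simps)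
  show ?thesis
  proof (cases "nproc (S t) \<le> 2")
    case True
    then show ?thesis using two by (simp add: l_def)
  next
    case False
    \<comment> \<open>Indices start at 0, so \<open>j\<close> is the largest index of a process
      whose successor exists.\<close>
    define j where "j = nproc (S t) - 2"
    have "Suc j < nproc (S t)" using False by (simp add: j_def)
    then have "\<epsilon> / (2 * exp 1) * exp (c ^ j) \<le> gap x0"
      using es_le_gap_if_nproc by (simp add: exp_targets_def)
    then have "exp (c ^ j) \<le> 2 * exp 1 * (gap x0 / \<epsilon>)"
      using eps_pos by (simp add: field_simps)
    then have "ln (exp (c ^ j)) \<le> ln (2 * exp 1 * (gap x0 / \<epsilon>))"
      by (intro ln_mono) auto
    also have "\<dots> = ln 2 + 1 + ln (gap x0 / \<epsilon>)"
      using ratio by (auto simp: ln_mult simp del: times_divide_eq_right)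
    also have "\<dots> \<le> 3 * ln (gap x0 / \<epsilon>)"
      using ln_le_minus_one[of 2] big by simp
    finally have "ln (c ^ j) \<le> ln (3 * ln (gap x0 / \<epsilon>))"
      using c_gt_1 by (intro ln_mono) auto
    also have "\<dots> = ln 3 + l" using big by (simp add: ln_mult l_def)
    also have "\<dots> \<le> 2 * l" using ln_le_minus_one[of 3] l by simp
    finally have "j * ln c \<le> 2 * l" using c_gt_1 by (simp add: ln_realpow)
    then have "real j \<le> 2 / ln c * l" using lnc by (simp add: field_simps)
    then show ?thesis
      using l False by (simp add: l_def[symmetric] j_def algebra_simps)
  qed
qed

lemma oracle_complexity_le:
  assumes "gap x0 / \<epsilon> \<ge> exp (exp 2)"
  shows "real (oracle_complexity E f \<epsilon> S) \<le>
    exp_targets_const p c * (1 + 2 / ln c) * oracle_rate M \<mu> p (gap x0) \<epsilon>"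
proof -
  let ?N = "(1 + 2 / ln c) * ln (ln (gap x0 / \<epsilon>))"
  have "0 \<le> ?N" using nproc_le[OF assms, of 0] by linarith
  have "real (oracle_complexity E f \<epsilon> S) = (\<Sum>t<iteration_complexity E f \<epsilon> S. real (nproc (S t)))"
    by (simp add: oracle_complexity_def)
  also have "\<dots> \<le> real (card {..<iteration_complexity E f \<epsilon> S}) * ?N"
    by (rule sum_bounded_above) (rule nproc_le[OF assms])
  also have "\<dots> \<le> exp_targets_const p c * iteration_rate M \<mu> p \<epsilon> * ?N"
    using iteration_complexity_le \<open>0 \<le> ?N\<close> by (simp only: card_lessThan) (rule mult_right_mono)
  finally show ?thesis by (simp add: oracle_rate_def mult_ac)
qed

end

section \<open>Lower bounds on the infima over all targets, and the theorem\<close>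

lemma
  assumes "p \<ge> 2" "0 < \<mu>" "0 < \<epsilon>" "\<Delta> / \<epsilon> \<ge> exp (exp 2)"
  shows iteration_bound_inf_ge:
      "(INF es\<in>admissible_targets \<epsilon>. iteration_bound M \<mu> p \<Delta> es) \<ge> 1 / 4 * iteration_rate M \<mu> p \<epsilon>"
    and oracle_bound_inf_ge:
      "(INF es\<in>admissible_targets \<epsilon>. (real (mhat_index \<Delta> es) + 1) * iteration_bound M \<mu> p \<Delta> es)
      \<ge> 1 / 4 * oracle_rate M \<mu> p \<Delta> \<epsilon>"
proof -
  note ll = ln_ln_le_double[OF assms(4)]
  have \<Delta>: "2 * \<epsilon> < \<Delta>" using ll(3) assms(3) by (simp add: field_simps)
  have R: "0 \<le> iteration_rate M \<mu> p \<epsilon>" by (simp add: iteration_rate_def)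
  \<comment> \<open>A real infimum can be bounded below by its members only over a nonempty
    set.\<close>
  have ne: "admissible_targets \<epsilon> \<noteq> {}"
    using exp_targets_admissible[OF assms(3), of 2] by auto
  have bound: "iteration_rate M \<mu> p \<epsilon> * normalized_bound p \<epsilon> \<Delta> es \<le> iteration_bound M \<mu> p \<Delta> es"
    and L: "3 \<le> normalized_bound p \<epsilon> \<Delta> es"
    if es: "es \<in> admissible_targets \<epsilon>" for es
  proof -
    show L: "3 \<le> normalized_bound p \<epsilon> \<Delta> es"
      using normalized_bound_ge(1)[OF assms(1) es assms(3)] \<Delta> assms(3) by simp
    have "1 \<le> 2 powr (2 / p)" using assms(1) by (intro ge_one_powr_ge_zero) auto
    then have "1 * (iteration_rate M \<mu> p \<epsilon> * normalized_bound p \<epsilon> \<Delta> es)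
      \<le> 2 powr (2 / p) * (iteration_rate M \<mu> p \<epsilon> * normalized_bound p \<epsilon> \<Delta> es)"
      using R L by (intro mult_right_mono) auto
    then show "iteration_rate M \<mu> p \<epsilon> * normalized_bound p \<epsilon> \<Delta> es \<le> iteration_bound M \<mu> p \<Delta> es"
      using iteration_bound_eq[of es \<mu> \<epsilon>] es assms by (simp add: admissible_targets_def mult.assoc)
  qed
  show "(INF es\<in>admissible_targets \<epsilon>. iteration_bound M \<mu> p \<Delta> es) \<ge> 1 / 4 * iteration_rate M \<mu> p \<epsilon>"
  proof (rule cINF_greatest[OF ne])
    fix es assume es: "es \<in> admissible_targets \<epsilon>"
    have "iteration_rate M \<mu> p \<epsilon> * (1 / 4) \<le> iteration_rate M \<mu> p \<epsilon> * normalized_bound p \<epsilon> \<Delta> es"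
      using R L[OF es] by (intro mult_left_mono) auto
    then show "1 / 4 * iteration_rate M \<mu> p \<epsilon> \<le> iteration_bound M \<mu> p \<Delta> es"
      using bound[OF es] by simp
  qed
  show "(INF es\<in>admissible_targets \<epsilon>. (real (mhat_index \<Delta> es) + 1) * iteration_bound M \<mu> p \<Delta> es)
      \<ge> 1 / 4 * oracle_rate M \<mu> p \<Delta> \<epsilon>"
  proof (rule cINF_greatest[OF ne])
    fix es assume es: "es \<in> admissible_targets \<epsilon>"
    let ?m = "real (m_index \<Delta> es) + 1" and ?n = "real (mhat_index \<Delta> es) + 1"
      and ?L = "normalized_bound p \<epsilon> \<Delta> es"
    have mn: "?m \<le> ?n"
      using m_index_le_mhat_index[of es \<Delta>] es assms(3) \<Delta> by (simp add: admissible_targets_def)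
    \<comment> \<open>This factor 2 and the 2 in \<open>ln_ln_le_normalized_bound\<close> produce
      the constant \<open>1 / 4\<close>.\<close>
    have "ln (ln (\<Delta> / \<epsilon>)) \<le> 2 * ln (ln (\<Delta> / (2 * \<epsilon>)))"
      using ll(2) by (simp add: mult.commute)
    also have "\<dots> \<le> 4 * (?m * ?L)"
      using ln_ln_le_normalized_bound[OF assms(1) es assms(3) \<Delta>] by (simp add: algebra_simps)
    also have "\<dots> \<le> 4 * (?n * ?L)"
      using mn L[OF es] by (intro mult_left_mono mult_right_mono) auto
    finally have "iteration_rate M \<mu> p \<epsilon> * ln (ln (\<Delta> / \<epsilon>)) \<le> iteration_rate M \<mu> p \<epsilon> * (4 * (?n * ?L))"
      using R by (rule mult_left_mono)
    also have "\<dots> = 4 * (?n * (iteration_rate M \<mu> p \<epsilon> * ?L))" by (simp only: mult_ac)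
    also have "\<dots> \<le> 4 * (?n * iteration_bound M \<mu> p \<Delta> es)"
      using bound[OF es] by (intro mult_left_mono) auto
    finally show "1 / 4 * oracle_rate M \<mu> p \<Delta> \<epsilon> \<le> ?n * iteration_bound M \<mu> p \<Delta> es"
      by (simp add: oracle_rate_def)
  qed
qed

theorem corollary4p6:
  fixes p c :: real
  assumes "p \<ge> 2" and "1 < c" and "c < 3 - 2 / p"
  shows "\<exists>C>0. \<exists>C'>0. \<exists>\<rho>>0.
    \<forall>d (E :: 'a::real_inner set) (f :: 'a \<Rightarrow> real) M \<mu> x0 \<Delta>0.
      euclidean_subspace d E \<and> M-lipschitz_on E f \<and> convex_on E f \<and> minimizers E f \<noteq> {} \<and>
      x0 \<in> E \<and> \<mu> > 0 \<and>
      (\<forall>x\<in>E. f x \<le> f x0 \<longrightarrow> f x - min_value E f \<ge> \<mu> * infdist x (minimizers E f) powr p) \<and>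
      \<Delta>0 = f x0 - min_value E f \<longrightarrow>
      (\<forall>\<epsilon>. 0 < \<epsilon> \<and> \<epsilon> < \<Delta>0 \<longrightarrow>
        (\<forall>S. scheme_run f (subgradient_step E f) (exp_targets \<epsilon> c) 1 x0 S \<longrightarrow>
          (\<exists>t. eps_optimal E f \<epsilon> (best (S t))) \<and>
          (\<epsilon> \<le> \<rho> * \<Delta>0 \<longrightarrow>
            real (iteration_complexity E f \<epsilon> S) \<le> C * iteration_rate M \<mu> p \<epsilon> \<and>
            real (oracle_complexity E f \<epsilon> S) \<le> C * oracle_rate M \<mu> p \<Delta>0 \<epsilon>)) \<and>
        (\<epsilon> \<le> \<rho> * \<Delta>0 \<longrightarrow>
          (INF es\<in>admissible_targets \<epsilon>. iteration_bound M \<mu> p \<Delta>0 es)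
            \<ge> C' * iteration_rate M \<mu> p \<epsilon> \<and>
          (INF es\<in>admissible_targets \<epsilon>.
             (real (mhat_index \<Delta>0 es) + 1) * iteration_bound M \<mu> p \<Delta>0 es)
            \<ge> C' * oracle_rate M \<mu> p \<Delta>0 \<epsilon>))"
proof -
  \<comment> \<open>The factor \<open>1 + 2 / ln c\<close> bounds the process count in the oracle
    complexity; being at least 1, it lets \<open>C\<close> serve for both complexities.\<close>
  define C where "C = exp_targets_const p c * (1 + 2 / ln c)"
  \<comment> \<open>With this choice \<open>\<epsilon> \<le> \<rho> * \<Delta>\<close> yields
    \<open>ln (ln (\<Delta> / \<epsilon>)) \<ge> 2\<close>.\<close>
  define \<rho> :: real where "\<rho> = exp (- exp 2)"
  have pos: "0 < exp_targets_const p c" by (rule exp_targets_const_pos) (use assms in auto)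
  have "0 < 2 / ln c" using assms by simp
  then have C: "exp_targets_const p c \<le> C" using pos by (simp add: C_def)
  then have C_pos: "0 < C" using pos by linarith
  have \<rho>: "\<Delta> / \<epsilon> \<ge> exp (exp 2)" if "0 < \<epsilon>" "\<epsilon> \<le> \<rho> * \<Delta>" for \<epsilon> \<Delta> :: real
    using that by (simp add: \<rho>_def exp_minus field_simps)
  show ?thesis
  proof (rule exI[of _ C], rule conjI[OF C_pos], rule exI[of _ "1 / 4"], rule conjI, simp,
      rule exI[of _ \<rho>], rule conjI, simp add: \<rho>_def, intro allI impI, elim conjE, intro conjI allI impI)
    fix d and E :: "'a set" and f :: "'a \<Rightarrow> real" and M \<mu> x0 \<Delta>0 \<epsilon> S
    assume "euclidean_subspace d E" "M-lipschitz_on E f" "minimizers E f \<noteq> {}" "x0 \<in> E" "\<mu> > 0"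
      "\<forall>x\<in>E. f x \<le> f x0 \<longrightarrow> f x - min_value E f \<ge> \<mu> * infdist x (minimizers E f) powr p"
      and \<Delta>0: "\<Delta>0 = f x0 - min_value E f" and \<epsilon>: "0 < \<epsilon>" "\<epsilon> < \<Delta>0"
      and "scheme_run f (subgradient_step E f) (exp_targets \<epsilon> c) 1 x0 S"
    moreover have "exp_targets \<epsilon> c \<in> admissible_targets \<epsilon>"
      using \<epsilon> assms by (intro exp_targets_admissible) auto
    ultimately interpret exp_restart_run E f M \<mu> p x0 \<epsilon> c S
      using assms by unfold_locales (auto simp: euclidean_subspace_imp_subspace admissible_targets_def)
    have gap: "gap x0 = \<Delta>0" by (simp add: gap_def \<Delta>0)
    show "\<exists>t. eps_optimal E f \<epsilon> (best (S t))" by (rule exists_eps_optimal)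
    have "exp_targets_const p c * iteration_rate M \<mu> p \<epsilon> \<le> C * iteration_rate M \<mu> p \<epsilon>"
      using C by (rule mult_right_mono) (simp add: iteration_rate_def)
    then show "real (iteration_complexity E f \<epsilon> S) \<le> C * iteration_rate M \<mu> p \<epsilon>"
      using iteration_complexity_le by linarith
    show "real (oracle_complexity E f \<epsilon> S) \<le> C * oracle_rate M \<mu> p \<Delta>0 \<epsilon>" if "\<epsilon> \<le> \<rho> * \<Delta>0"
      using oracle_complexity_le \<rho>[OF \<epsilon>(1) that] by (simp add: C_def gap)
  next
    fix M \<mu> \<Delta>0 \<epsilon> :: real
    assume "0 < \<epsilon>" "0 < \<mu>" "\<epsilon> \<le> \<rho> * \<Delta>0"
    note bound_assms = assms(1) this(2,1) \<rho>[OF this(1,3)]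
    show "1 / 4 * iteration_rate M \<mu> p \<epsilon> \<le> (INF es\<in>admissible_targets \<epsilon>. iteration_bound M \<mu> p \<Delta>0 es)"
      by (rule iteration_bound_inf_ge[OF bound_assms])
    show "1 / 4 * oracle_rate M \<mu> p \<Delta>0 \<epsilon> \<le> (INF es\<in>admissible_targets \<epsilon>.
        (real (mhat_index \<Delta>0 es) + 1) * iteration_bound M \<mu> p \<Delta>0 es)"
      by (rule oracle_bound_inf_ge[OF bound_assms])
  qed
qed

end
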